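(* Assume that $G^{(2)}(1)=\mathbb E[N(N-1)]$ is finite. Let $i\le k$ be positive integers and assume that $\bar x_i\in[0,\frac1i]$ is a linearly attracting fixed point of the function $h_i$ whose basin of attraction contains $(0,\frac1i]$. Then $\bar x_i\in(0,\frac1i]$, and $\bar{\mathbf x}=(1-i\bar x_i,\bar x_i,\dots,\bar x_i,0_{k-i})$ (with $\bar x_i$ repeated $i$ times) is a globally attracting fixed point for $$H:\mathscr Q_{k,i}\to\mathscr Q_{k,i},\qquad \mathscr Q_{k,i}=\{\mathbf p\in\mathscr Q_k:\ \mathbf p_1=\dots=\mathbf p_i>\mathbf p_{i+1}\ge\dots\ge\mathbf p_k\}.$$
   Context: Let $q=(q_n)_{n\in\mathbb N}$ be a probability distribution on $\mathbb N$ with $q_0+q_1=0$, $N$ a random variable of law $q$, and $G(s)=\mathbb E[s^N]=\sum_n q_ns^n$. $\mathscr P_k:=\{\mathbf p=(\mathbf p_0,\dots,\mathbf p_k)\in(\mathbb R_+)^{k+1}:\sum_{i=0}^k\mathbf p_i=1,\ \mathbf p_0<1\}$ and $\mathscr Q_k:=\{\mathbf p\in\mathscr P_k:\ \mathbf p_1\ge\dots\ge\mathbf p_k\}$. $0_r$ denotes $r$ zero coordinates. For $i=k$, $\mathscr Q_{k,k}=\{\mathbf p\in\mathscr Q_k:\mathbf p_1=\dots=\mathbf p_k\}$. The map $H:\mathscr P_k\to\mathscr P_k$ is defined, for $1\le i\le k$, by $$H_i(\mathbf p)=\sum_{n\ge2}q_n\sum_{m_0=0}^{n-1}\binom{n}{m_0}\mathbf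 p_0^{m_0}\sum_{(m_1,\dots,m_k)\in S^i_{n-m_0}}\binom{n-m_0}{m_1,\dots,m_k}\prod_{j=1}^k\mathbf p_j^{m_j},\qquad H_0(\mathbf p)=1-\sum_{j=1}^kH_j(\mathbf p),$$ with $S^i_r=\{(m_1,\dots,m_k)\in\mathbb N^k:\ m_j<m_i\ \forall j\ne i,\ \sum_{j=1}^km_j=r\}$. It maps $\mathscr Q_{k,i}$ into itself. The function $h_i:[0,\frac1i]\to[0,\frac1i]$ is $$h_i(x)=\sum_{n\ge2}q_n\sum_{m_0=0}^{n-1}\binom{n}{m_0}(1-ix)^{m_0}\sum_{(m_1,\dots,m_i)\in S}\binom{n-m_0}{m_1,\dots,m_i}x^{n-m_0},$$ where $S=\{(m_1,\dots,m_i)\in\mathbb N^i:\ m_j<m_1\ \forall j\ne1,\ \sum_{j=1}^i m_j=n-m_0\}$; equivalently, in $\mathscr P_i$, $H(1-ix,x,\dots,x)=(1-ih_i(x),h_i(x),\dots,h_i(x))$. A fixed point $x$ of a real function $g$ is linearly attracting if $g$ is differentiable at $x$ (one-sidedly at an endpoint of the domain) and $|g'(x)|<1$. The basin of attraction of a fixed point is the set of points whose forward orbit converges to it. A fixed point is attracting if all orbits starting sufficiently close to it converge to it, and globally attracting on a set if it is attracting and every orbit starting in that set converges to it. *)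

theory Defs
  imports "HOL-Probability.Probability"
begin

section \<open>Fixed points of discrete dynamical systems\<close>

definition is_fixed_point :: "('a \<Rightarrow> 'a) \<Rightarrow> 'a set \<Rightarrow> 'a \<Rightarrow> bool"
  where "is_fixed_point g S x \<longleftrightarrow> x \<in> S \<and> g x = x"

definition basin :: "('a::topological_space \<Rightarrow> 'a) \<Rightarrow> 'a set \<Rightarrow> 'a \<Rightarrow> 'a set"
  where "basin g S x = {y \<in> S. (\<lambda>n. (g ^^ n) y) \<longlonglongrightarrow> x}"

text \<open>The derivative is taken within the domain \<open>S\<close>, hence one-sidedly at an endpoint of an
  interval.\<close>

definition linearly_attracting :: "(real \<Rightarrow> real) \<Rightarrow> real set \<Rightarrow> real \<Rightarrow> bool"
  where "linearly_attracting g S x \<longleftrightarrow> is_fixed_point g S x \<and>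
    (\<exists>D. (g has_real_derivative D) (at x within S) \<and> \<bar>D\<bar> < 1)"

definition attracting :: "('a::topological_space \<Rightarrow> 'a) \<Rightarrow> 'a set \<Rightarrow> 'a \<Rightarrow> bool"
  where "attracting g S x \<longleftrightarrow> is_fixed_point g S x \<and>
    (\<forall>\<^sub>F y in at x within S. y \<in> basin g S x)"

definition globally_attracting :: "('a::topological_space \<Rightarrow> 'a) \<Rightarrow> 'a set \<Rightarrow> 'a \<Rightarrow> bool"
  where "globally_attracting g S x \<longleftrightarrow> attracting g S x \<and> S \<subseteq> basin g S x"

section \<open>The spaces of probability vectors\<close>

text \<open>A vector \<open>(p\<^sub>0, \<dots>, p\<^sub>k)\<close> is a function on \<open>nat\<close> that vanishes beyond \<open>k\<close>. On these functions
  the (product) topology of \<^typ>\<open>nat \<Rightarrow> real\<close> is the Euclidean topology in dimension \<open>k + 1\<close>.\<close>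

definition Pspace :: "nat \<Rightarrow> (nat \<Rightarrow> real) set"
  where "Pspace k = {p. (\<forall>j\<le>k. 0 \<le> p j) \<and> (\<forall>j>k. p j = 0) \<and> (\<Sum>j\<le>k. p j) = 1 \<and> p 0 < 1}"

definition Qspace :: "nat \<Rightarrow> (nat \<Rightarrow> real) set"
  where "Qspace k = {p \<in> Pspace k. \<forall>j\<in>{1..<k}. p (Suc j) \<le> p j}"

definition Qspace_tied :: "nat \<Rightarrow> nat \<Rightarrow> (nat \<Rightarrow> real) set"
  where "Qspace_tied k i =
    {p \<in> Qspace k. (\<forall>j\<in>{1..i}. p j = p 1) \<and> (i < k \<longrightarrow> p (Suc i) < p i)}"

section \<open>The maps \<open>H\<close> and \<open>h\<^sub>i\<close>\<close>

text \<open>\<open>winning k i r\<close> is \<open>S\<^sup>i\<^sub>r\<close>: count vectors \<open>(m\<^sub>1, \<dots>, m\<^sub>k)\<close> of total \<open>r\<close>, extended by \<open>0\<close> to all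
  of \<open>nat\<close>, whose unique maximum is at \<open>i\<close>.\<close>

definition winning :: "nat \<Rightarrow> nat \<Rightarrow> nat \<Rightarrow> (nat \<Rightarrow> nat) set"
  where "winning k i r = {m. (\<forall>j. j \<notin> {1..k} \<longrightarrow> m j = 0) \<and>
    (\<forall>j\<in>{1..k}. j \<noteq> i \<longrightarrow> m j < m i) \<and> (\<Sum>j=1..k. m j) = r}"

definition multinomial :: "nat \<Rightarrow> nat \<Rightarrow> (nat \<Rightarrow> nat) \<Rightarrow> real"
  where "multinomial k r m = fact r / (\<Prod>j=1..k. fact (m j))"

definition H_comp :: "nat pmf \<Rightarrow> nat \<Rightarrow> nat \<Rightarrow> (nat \<Rightarrow> real) \<Rightarrow> real"
  where "H_comp q k i p = (\<Sum>\<^sub>\<infinity>n\<in>{2..}. pmf q n *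
    (\<Sum>m0=0..n-1. real (n choose m0) * p 0 ^ m0 *
      (\<Sum>m\<in>winning k i (n - m0). multinomial k (n - m0) m * (\<Prod>j=1..k. p j ^ m j))))"

definition H :: "nat pmf \<Rightarrow> nat \<Rightarrow> (nat \<Rightarrow> real) \<Rightarrow> (nat \<Rightarrow> real)"
  where "H q k p = (\<lambda>i. if i = 0 then 1 - (\<Sum>j=1..k. H_comp q k j p)
    else if i \<le> k then H_comp q k i p else 0)"

definition h :: "nat pmf \<Rightarrow> nat \<Rightarrow> real \<Rightarrow> real"
  where "h q i x = (\<Sum>\<^sub>\<infinity>n\<in>{2..}. pmf q n *
    (\<Sum>m0=0..n-1. real (n choose m0) * (1 - real i * x) ^ m0 *
      (\<Sum>m\<in>winning i 1 (n - m0). multinomial i (n - m0) m * x ^ (n - m0))))"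

definition tied_vector :: "nat \<Rightarrow> real \<Rightarrow> (nat \<Rightarrow> real)"
  where "tied_vector i x = (\<lambda>j. if j = 0 then 1 - real i * x else if j \<le> i then x else 0)"

end

theory Submission
  imports Defs
begin

text \<open>
  Exchanging the counts of two candidates \<open>u\<close> and \<open>v\<close> with \<open>p\<^sub>v \<le> \<rho> p\<^sub>u\<close> and \<open>\<rho> \<le> 1\<close> costs, in each
  monomial of \<open>H\<^sub>u\<close>, a factor \<open>\<rho>\<close> to the power of the winning margin. Every margin is at least 1, so
  ratios never grow; the unanimous vote has margin \<open>N \<ge> 2\<close>, which gives
  \<open>H\<^sub>v \<le> \<rho> H\<^sub>u - \<rho> (1 - \<rho>) E[p\<^sub>u\<^sup>N]\<close>. Near \<open>p\<^sub>0 = 1\<close> the leading coordinate grows, because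
  \<open>H\<^sub>1 \<ge> p\<^sub>1 E[N p\<^sub>0\<^bsup>N-1\<^esup>]\<close> and \<open>E[N] \<ge> 2\<close>; elsewhere it is bounded below by \<open>E[p\<^sub>1\<^sup>N]\<close>. Hence it stays away
  from 0 along an orbit, and \<open>p\<^sub>i\<^sub>+\<^sub>1 / p\<^sub>1\<close> decays geometrically. So \<open>p\<^sub>1\<close> follows an asymptotically
  vanishing perturbation of the orbit of \<open>h\<^sub>i\<close> inside a compact subset of the basin, which converges
  by linear attraction. The same growth estimate gives \<open>h\<^sub>i'(0) \<ge> 2\<close>, so the fixed point is not 0.
\<close>

section \<open>Perturbed orbits of an interval map\<close>

text \<open>Compactness replaces uniform convergence on the basin: the perturbed orbit has a limit
  point \<open>l\<close> in \<open>K\<close>, and over any fixed number of steps it shadows the true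
  orbit of \<open>l\<close>, hence reaches the ball around \<open>x\<close> on which linear
  attraction makes \<open>g\<close> contract.\<close>

lemma perturbed_orbit_converges:
  fixes g :: "real \<Rightarrow> real" and X :: "nat \<Rightarrow> real"
  assumes cont: "continuous_on S g"
    and K: "compact K" "K \<subseteq> S" "K \<subseteq> basin g S x"
    and attr: "linearly_attracting g S x"
    and X: "\<And>t. X t \<in> K" "(\<lambda>t. X (Suc t) - g (X t)) \<longlonglongrightarrow> 0"
  shows "X \<longlonglongrightarrow> x"
proof -
  obtain D where gx: "g x = x" and D: "(g has_real_derivative D) (at x within S)" "\<bar>D\<bar> < 1"
    using attr by (auto simp: linearly_attracting_def is_fixed_point_def)
  \<comment> \<open>The midpoint of \<open>\<bar>D\<bar>\<close> and 1: the gap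
    \<open>L - \<bar>D\<bar>\<close> is spent on the error of the linear approximation.\<close>
  define L where "L = (1 + \<bar>D\<bar>) / 2"
  have L: "L < 1" "0 < L - \<bar>D\<bar>" using D(2) by (auto simp: L_def field_simps)
  have "\<forall>e>0. \<exists>r>0. \<forall>y\<in>S. norm (y - x) < r \<longrightarrow> norm (g y - g x - D * (y - x)) \<le> e * norm (y - x)"
    using D(1) unfolding has_field_derivative_def has_derivative_within_alt by (rule conjunct2)
  from this[rule_format, OF L(2)] obtain r where r: "0 < r" and
    approx: "\<And>y. y \<in> S \<Longrightarrow> \<bar>y - x\<bar> < r \<Longrightarrow> \<bar>g y - g x - D * (y - x)\<bar> \<le> (L - \<bar>D\<bar>) * \<bar>y - x\<bar>"
    unfolding real_norm_def by metis
  have contr: "\<bar>g y - x\<bar> \<le> L * \<bar>y - x\<bar>" if "y \<in> S" "\<bar>y - x\<bar> < r" for y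
  proof -
    have "\<bar>g y - x\<bar> \<le> \<bar>g y - g x - D * (y - x)\<bar> + \<bar>D * (y - x)\<bar>"
      using gx by linarith
    also have "\<dots> \<le> (L - \<bar>D\<bar>) * \<bar>y - x\<bar> + \<bar>D\<bar> * \<bar>y - x\<bar>"
      using approx[OF that] by (simp add: abs_mult)
    finally show ?thesis by (simp add: algebra_simps)
  qed
  obtain l s where l: "l \<in> K" and s: "strict_mono s" "(X \<circ> s) \<longlonglongrightarrow> l"
    using K(1) X(1) unfolding compact_def by metis
  have orbit: "(\<lambda>j. X (s j + n)) \<longlonglongrightarrow> (g ^^ n) l" for n
  proof (induction n)
    case 0
    then show ?case using s(2) by (simp add: comp_def)
  next
    case (Suc n)
    have "(g ^^ n) l \<in> K"
      \<comment> \<open>The iterate lies in \<open>K\<close> as a limit of the points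
        \<open>X (s j + n)\<close> of this closed set.\<close>
      using closed_sequentially[OF compact_imp_closed[OF K(1)] _ Suc] X(1) by simp
    then have 1: "(\<lambda>j. g (X (s j + n))) \<longlonglongrightarrow> g ((g ^^ n) l)"
      using X(1) K(2) by (intro continuous_on_tendsto_compose[OF cont Suc] always_eventually) auto
    have "filterlim (\<lambda>j. s j + n) sequentially sequentially"
      using filterlim_subseq[OF s(1)] by (rule filterlim_at_top_mono) auto
    from filterlim_compose[OF X(2) this]
    have 2: "(\<lambda>j. X (Suc (s j + n)) - g (X (s j + n))) \<longlonglongrightarrow> 0" .
    show ?case using tendsto_add[OF 2 1] by simp
  qed
  \<comment> \<open>Once the orbit, shadowing that of \<open>l\<close>, enters the \<open>\<epsilon>\<close>-ball, contraction outweighs the error and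
    it cannot leave.\<close>
  have near: "\<forall>\<^sub>F t in sequentially. \<bar>X t - x\<bar> < \<epsilon>" if \<epsilon>: "0 < \<epsilon>" "\<epsilon> \<le> r" for \<epsilon>
  proof -
    have "(\<lambda>n. (g ^^ n) l) \<longlonglongrightarrow> x" using l K(3) by (auto simp: basin_def)
    from LIMSEQ_D[OF this \<epsilon>(1)] obtain n where n: "\<bar>(g ^^ n) l - x\<bar> < \<epsilon>" by auto
    have "(\<lambda>j. \<bar>X (s j + n) - x\<bar>) \<longlonglongrightarrow> \<bar>(g ^^ n) l - x\<bar>"
      by (intro tendsto_intros orbit)
    from order_tendstoD(2)[OF this n] obtain J where J: "\<And>j. j \<ge> J \<Longrightarrow> \<bar>X (s j + n) - x\<bar> < \<epsilon>"
      by (auto simp: eventually_sequentially)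
    have "0 < (1 - L) * \<epsilon>" using L \<epsilon> by simp
    from LIMSEQ_D[OF X(2) this] obtain T where
      T: "\<And>t. t \<ge> T \<Longrightarrow> \<bar>X (Suc t) - g (X t)\<bar> < (1 - L) * \<epsilon>" by auto
    \<comment> \<open>Since \<open>j \<le> s j\<close>, taking \<open>max J T\<close> also ensures
      \<open>T \<le> T1\<close>, so the errors are small from \<open>T1\<close> on.\<close>
    define T1 where "T1 = s (max J T) + n"
    have T1: "T \<le> T1" "\<bar>X T1 - x\<bar> < \<epsilon>"
      using seq_suble[OF s(1), of "max J T"] J[of "max J T"] by (auto simp: T1_def)
    have "\<bar>X t - x\<bar> < \<epsilon>" if "T1 \<le> t" for t
      using that
    proof (induction t rule: dec_induct)
      case base
      then show ?case by (rule T1)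
    next
      case (step t)
      have "\<bar>g (X t) - x\<bar> \<le> L * \<bar>X t - x\<bar>"
        using contr[of "X t"] X(1) K(2) step \<epsilon> by auto
      also have "\<dots> \<le> L * \<epsilon>" using step L by (intro mult_left_mono) auto
      finally show ?case using T[of t] T1 step by (simp add: algebra_simps)
    qed
    then show ?thesis by (auto simp: eventually_sequentially)
  qed
  show ?thesis
  proof (rule tendstoI)
    fix e :: real assume "0 < e"
    then show "\<forall>\<^sub>F t in sequentially. dist (X t) x < e"
      using near[of "min e r"] r by (auto simp: dist_real_def elim: eventually_mono)
  qed
qed

text \<open>The topology of a function type is the product topology, whose limits are
  pointwise.\<close>

lemma tendsto_funI:
  fixes f :: "'b \<Rightarrow> 'a \<Rightarrow> 'c::topological_space"
  assumes "\<And>j. ((\<lambda>t. f t j) \<longlongrightarrow> l j) F"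
  shows "(f \<longlongrightarrow> l) F"
proof -
  have "limitin (product_topology (\<lambda>_. euclidean) UNIV) f l F"
    unfolding limitin_componentwise using assms by simp
  then show ?thesis by (simp add: euclidean_product_topology)
qed

section \<open>Plurality votes with a fixed number of voters\<close>

definition prob_vectors :: "nat \<Rightarrow> (nat \<Rightarrow> real) set"
  where "prob_vectors k = {p. (\<forall>j\<le>k. 0 \<le> p j) \<and> (\<Sum>j\<le>k. p j) = 1}"

definition compositions :: "nat \<Rightarrow> nat \<Rightarrow> (nat \<Rightarrow> nat) set"
  where "compositions k r = {m. (\<forall>j. j \<notin> {1..k} \<longrightarrow> m j = 0) \<and> (\<Sum>j=1..k. m j) = r}"

definition multi_term :: "nat \<Rightarrow> (nat \<Rightarrow> real) \<Rightarrow> nat \<Rightarrow> (nat \<Rightarrow> nat) \<Rightarrow> real"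
  where "multi_term k p r m = multinomial k r m * (\<Prod>j=1..k. p j ^ m j)"

definition win_sum :: "nat \<Rightarrow> nat \<Rightarrow> nat \<Rightarrow> (nat \<Rightarrow> real) \<Rightarrow> real"
  where "win_sum k i r p = (\<Sum>m\<in>winning k i r. multi_term k p r m)"

text \<open>For \<open>n \<ge> 1\<close>, the probability that candidate \<open>i\<close> strictly
  beats all others among \<open>n\<close> independent voters of law \<open>p\<close>, index 0
  meaning abstention. The cutoff \<open>n - 1\<close> matters for \<open>k = 1\<close>, where the
  zero count vector would pass as a win.\<close>

definition win_prob :: "nat \<Rightarrow> nat \<Rightarrow> nat \<Rightarrow> (nat \<Rightarrow> real) \<Rightarrow> real"
  where "win_prob k i n p =
    (\<Sum>m0=0..n-1. real (n choose m0) * p 0 ^ m0 * win_sum k i (n - m0) p)"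

section \<open>Count vectors and the multinomial expansion\<close>

lemma finite_compositions: "finite (compositions k r)"
proof (rule finite_subset)
  show "compositions k r \<subseteq> {m. \<forall>j. (j \<in> {1..k} \<longrightarrow> m j \<in> {0..r}) \<and> (j \<notin> {1..k} \<longrightarrow> m j = 0)}"
  proof
    fix m assume m: "m \<in> compositions k r"
    then have "m j \<le> r" if "j \<in> {1..k}" for j
      using member_le_sum[of j "{1..k}" m] that by (auto simp: compositions_def)
    with m show "m \<in> {m. \<forall>j. (j \<in> {1..k} \<longrightarrow> m j \<in> {0..r}) \<and> (j \<notin> {1..k} \<longrightarrow> m j = 0)}"
      by (auto simp: compositions_def)
  qed
  show "finite {m. \<forall>j. (j \<in> {1..k} \<longrightarrow> m j \<in> {0..r}) \<and> (j \<notin> {1..k} \<longrightarrow> m j = (0::nat))}"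
    by (rule finite_set_of_finite_funs) auto
qed

lemma winning_subset_compositions: "winning k i r \<subseteq> compositions k r"
  by (auto simp: winning_def compositions_def)

lemma finite_winning: "finite (winning k i r)"
  by (rule finite_subset[OF winning_subset_compositions finite_compositions])

lemma multinomial_nonneg: "0 \<le> multinomial k r m"
  by (simp add: multinomial_def prod_nonneg)

lemma multi_term_nonneg: "\<forall>j\<in>{1..k}. 0 \<le> p j \<Longrightarrow> 0 \<le> multi_term k p r m"
  unfolding multi_term_def by (intro mult_nonneg_nonneg multinomial_nonneg prod_nonneg) auto

text \<open>Splitting off the count \<open>s\<close> of the last candidate turns the sum over count
  vectors into a binomial expansion.\<close>

lemma multinomial_theorem:
  "(\<Sum>m\<in>compositions k r. multi_term k p r m) = (\<Sum>j=1..k. p j) ^ r"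
proof (induction k arbitrary: r)
  case 0
  have "compositions 0 r = (if r = 0 then {\<lambda>_. 0} else {})"
    by (auto simp: compositions_def)
  then show ?case by (simp add: multi_term_def multinomial_def)
next
  case (Suc k)
  let ?C = "SIGMA s:{..r}. compositions k (r - s)"
  let ?f = "\<lambda>(s, m). m(Suc k := s)"
  let ?g = "\<lambda>m. (m (Suc k), m(Suc k := 0))"
  have sum_upd: "(\<Sum>j=1..k. (m(Suc k := s)) j) = (\<Sum>j=1..k. m j)" for m :: "nat \<Rightarrow> nat" and s
    by (rule sum.cong) auto
  have "(\<Sum>m\<in>compositions (Suc k) r. multi_term (Suc k) p r m)
      = (\<Sum>sm\<in>?C. multi_term (Suc k) p r (?f sm))"
  proof (rule sum.reindex_bij_witness[where i = ?f and j = ?g])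
    fix m assume m: "m \<in> compositions (Suc k) r"
    show "?g m \<in> ?C"
      using m sum_upd[of m 0] by (auto simp: compositions_def)
    show "?f (?g m) = m" by simp
    show "multi_term (Suc k) p r (?f (?g m)) = multi_term (Suc k) p r m" by simp
  next
    fix b assume b: "b \<in> ?C"
    show "?g (?f b) = b"
      using b by (auto simp: compositions_def)
    show "?f b \<in> compositions (Suc k) r"
      using b by (auto simp: compositions_def sum_upd)
  qed
  also have "\<dots> = (\<Sum>s\<le>r. \<Sum>m\<in>compositions k (r - s). multi_term (Suc k) p r (m(Suc k := s)))"
    by (subst sum.Sigma) (auto simp: finite_compositions case_prod_beta intro!: sum.cong)
  also have "\<dots> = (\<Sum>s\<le>r. \<Sum>m\<in>compositions k (r - s).
      real (r choose s) * p (Suc k) ^ s * multi_term k p (r - s) m)"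
  proof (intro sum.cong refl)
    fix s m assume s: "s \<in> {..r}"
    have "multi_term (Suc k) p r (m(Suc k := s)) =
        fact r / ((\<Prod>j=1..k. fact (m j)) * fact s) * ((\<Prod>j=1..k. p j ^ m j) * p (Suc k) ^ s)"
      by (simp add: multi_term_def multinomial_def)
    also have "\<dots> = real (r choose s) * p (Suc k) ^ s * multi_term k p (r - s) m"
      using s by (simp add: multi_term_def multinomial_def binomial_fact mult_ac)
    finally show "multi_term (Suc k) p r (m(Suc k := s)) = \<dots>" .
  qed
  also have "\<dots> = (\<Sum>s\<le>r. real (r choose s) * p (Suc k) ^ s * (\<Sum>j=1..k. p j) ^ (r - s))"
    by (simp add: Suc sum_distrib_left[symmetric])
  also have "\<dots> = (\<Sum>j=1..Suc k. p j) ^ r"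
    by (simp add: binomial_ring[symmetric] add.commute)
  finally show ?case .
qed

lemma win_sum_nonneg: "\<forall>j\<in>{1..k}. 0 \<le> p j \<Longrightarrow> 0 \<le> win_sum k i r p"
  unfolding win_sum_def by (intro sum_nonneg multi_term_nonneg)

text \<open>A count vector has at most one winner, so the winning sets are disjoint; ties account
  for the slack.\<close>

lemma sum_win_sum_le:
  assumes "\<forall>j\<in>{1..k}. 0 \<le> p j"
  shows "(\<Sum>i=1..k. win_sum k i r p) \<le> (\<Sum>j=1..k. p j) ^ r"
proof -
  have disj: "winning k i r \<inter> winning k j r = {}" if "i \<in> {1..k}" "j \<in> {1..k}" "i \<noteq> j" for i j
  proof -
    have False if "m \<in> winning k i r" "m \<in> winning k j r" for m
    proof -
      have "m i < m j" "m j < m i"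
        using that \<open>i \<in> _\<close> \<open>j \<in> _\<close> \<open>i \<noteq> j\<close> by (simp_all add: winning_def)
      then show False by simp
    qed
    then show ?thesis by blast
  qed
  have "(\<Sum>i=1..k. win_sum k i r p) = (\<Sum>m\<in>(\<Union>i\<in>{1..k}. winning k i r). multi_term k p r m)"
    unfolding win_sum_def by (subst sum.UNION_disjoint) (auto simp: finite_winning disj)
  also have "\<dots> \<le> (\<Sum>m\<in>compositions k r. multi_term k p r m)"
    using winning_subset_compositions assms
    by (intro sum_mono2 multi_term_nonneg) (auto simp: finite_compositions)
  finally show ?thesis by (simp add: multinomial_theorem)
qed

lemma prob_vectorsD:
  assumes "p \<in> prob_vectors k"
  shows "j \<le> k \<Longrightarrow> 0 \<le> p j" "j \<le> k \<Longrightarrow> p j \<le> 1" "\<forall>j\<in>{1..k}. 0 \<le> p j"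
    "p 0 + (\<Sum>j=1..k. p j) = 1"
proof -
  have nn: "0 \<le> p j" if "j \<le> k" for j
    using assms that by (auto simp: prob_vectors_def)
  then show "j \<le> k \<Longrightarrow> 0 \<le> p j" .
  show "\<forall>j\<in>{1..k}. 0 \<le> p j" using nn by auto
  have s: "(\<Sum>j\<le>k. p j) = 1" using assms by (auto simp: prob_vectors_def)
  then show "j \<le> k \<Longrightarrow> p j \<le> 1"
    using member_le_sum[of j "{..k}" p] nn by auto
  show "p 0 + (\<Sum>j=1..k. p j) = 1"
    using s by (simp add: atMost_atLeast0 sum.atLeast_Suc_atMost)
qed

lemma win_prob_nonneg:
  assumes "p \<in> prob_vectors k"
  shows "0 \<le> win_prob k i n p"
  unfolding win_prob_def
  by (intro sum_nonneg mult_nonneg_nonneg zero_le_power win_sum_nonneg) (use prob_vectorsD[OF assms] in auto)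

lemma sum_win_prob_le_1:
  assumes "p \<in> prob_vectors k"
  shows "(\<Sum>i=1..k. win_prob k i n p) \<le> 1"
proof -
  have "(\<Sum>i=1..k. win_prob k i n p) =
      (\<Sum>m0=0..n-1. real (n choose m0) * p 0 ^ m0 * (\<Sum>i=1..k. win_sum k i (n - m0) p))"
    unfolding win_prob_def by (subst sum.swap) (simp add: sum_distrib_left)
  also have "\<dots> \<le> (\<Sum>m0=0..n-1. real (n choose m0) * p 0 ^ m0 * (\<Sum>j=1..k. p j) ^ (n - m0))"
    by (intro sum_mono mult_left_mono sum_win_sum_le) (use prob_vectorsD[OF assms] in auto)
  \<comment> \<open>Extending the range to \<open>{..n}\<close> completes the binomial expansion of
    a power of \<open>p 0 + (\<Sum>j=1..k. p j) = 1\<close>.\<close>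
  also have "\<dots> \<le> (\<Sum>m0\<le>n. real (n choose m0) * p 0 ^ m0 * (\<Sum>j=1..k. p j) ^ (n - m0))"
    by (intro sum_mono2) (auto intro!: mult_nonneg_nonneg zero_le_power sum_nonneg prob_vectorsD(1)[OF assms])
  also have "\<dots> = 1"
    by (simp only: binomial_ring[symmetric] prob_vectorsD(4)[OF assms] power_one)
  finally show ?thesis .
qed

lemma win_prob_le_1:
  assumes "p \<in> prob_vectors k" "i \<in> {1..k}"
  shows "win_prob k i n p \<le> 1"
proof -
  have "win_prob k i n p \<le> (\<Sum>i=1..k. win_prob k i n p)"
    using assms by (intro member_le_sum) (auto simp: win_prob_nonneg)
  also have "\<dots> \<le> 1" by (rule sum_win_prob_le_1[OF assms(1)])
  finally show ?thesis .
qed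

section \<open>Exchanging the votes of two candidates\<close>

text \<open>Swapping two counts is an involution that carries wins of one candidate to wins of the
  other, so one inclusion, stated for arbitrary \<open>a\<close> and \<open>b\<close>, yields
  both.\<close>

lemma winning_transpose:
  assumes "u \<in> {1..k}" "v \<in> {1..k}"
  shows "winning k v r = (\<lambda>m. m \<circ> Transposition.transpose u v) ` winning k u r"
proof -
  let ?\<tau> = "Transposition.transpose u v"
  have mem: "m \<circ> Transposition.transpose a b \<in> winning k b r"
    if "m \<in> winning k a r" "a \<in> {1..k}" "b \<in> {1..k}" for m a b
  proof -
    let ?t = "Transposition.transpose a b"
    have perm: "?t permutes {1..k}" using that by (intro permutes_swap_id)
    have "(\<Sum>j=1..k. (m \<circ> ?t) j) = (\<Sum>j=1..k. m j)"
      using sum.permute[OF perm, of m] by (simp add: comp_def)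
    moreover have "m (?t j) = 0" if "j \<notin> {1..k}" for j
      using \<open>m \<in> _\<close> permutes_not_in[OF perm that] that by (simp add: winning_def)
    moreover have "m (?t j) < m (?t b)" if "j \<in> {1..k}" "j \<noteq> b" for j
    proof -
      have "?t j \<in> {1..k}" using permutes_in_image[OF perm, of j] that by simp
      moreover have "?t j \<noteq> a" using that by (metis transpose_eq_iff)
      ultimately show ?thesis using \<open>m \<in> _\<close> by (simp add: winning_def)
    qed
    ultimately show ?thesis using \<open>m \<in> _\<close> by (simp add: winning_def)
  qed
  show ?thesis
  proof
    show "winning k v r \<subseteq> (\<lambda>m. m \<circ> ?\<tau>) ` winning k u r"
    proof
      fix m assume "m \<in> winning k v r"
      then have "m \<circ> ?\<tau> \<in> winning k u r"
        using mem[of m v u] assms by (simp add: transpose_commute)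
      then show "m \<in> (\<lambda>m. m \<circ> ?\<tau>) ` winning k u r"
        by (intro image_eqI[of _ _ "m \<circ> ?\<tau>"]) (auto simp: fun_eq_iff)
    qed
  qed (use mem assms in auto)
qed

text \<open>The multinomial coefficient and all factors other than those of \<open>u\<close> and
  \<open>v\<close> are unchanged; the swap replaces \<open>m u - m v\<close> factors
  \<open>p u\<close> by \<open>p v\<close>, each at the cost of \<open>\<rho>\<close>.\<close>

lemma multi_term_transpose_le:
  assumes uv: "u \<in> {1..k}" "v \<in> {1..k}" "u \<noteq> v"
    and nn: "\<forall>j\<in>{1..k}. 0 \<le> p j"
    and \<rho>: "0 \<le> \<rho>" "p v \<le> \<rho> * p u" and mvu: "m v \<le> m u"
  shows "multi_term k p r (m \<circ> Transposition.transpose u v) \<le> \<rho> ^ (m u - m v) * multi_term k p r m"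
proof -
  let ?\<tau> = "Transposition.transpose u v"
  let ?R = "\<Prod>j\<in>{1..k} - {u} - {v}. p j ^ m j"
  have perm: "?\<tau> permutes {1..k}" using uv by (intro permutes_swap_id)
  have mult: "multinomial k r (m \<circ> ?\<tau>) = multinomial k r m"
    unfolding multinomial_def using prod.permute[OF perm, of "\<lambda>j. fact (m j) :: real"]
    by (simp add: comp_def)
  have split: "(\<Prod>j=1..k. g j) = g u * (g v * (\<Prod>j\<in>{1..k} - {u} - {v}. g j))" for g :: "nat \<Rightarrow> real"
    using uv by (subst prod.remove[of _ u], simp, simp, subst prod.remove[of _ v]) auto
  have R: "(\<Prod>j\<in>{1..k} - {u} - {v}. p j ^ (m \<circ> ?\<tau>) j) = ?R"
    by (intro prod.cong refl) (auto simp: transpose_def)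
  have "p v ^ (m u - m v) \<le> (\<rho> * p u) ^ (m u - m v)"
    using nn uv \<rho> by (intro power_mono) auto
  then have "p u ^ m v * p v ^ m v * p v ^ (m u - m v)
      \<le> p u ^ m v * p v ^ m v * (\<rho> * p u) ^ (m u - m v)"
    using nn uv by (intro mult_left_mono) auto
  moreover have "p v ^ m u = p v ^ m v * p v ^ (m u - m v)" "p u ^ m u = p u ^ m v * p u ^ (m u - m v)"
    using mvu by (simp_all flip: power_add)
  ultimately have *: "p u ^ m v * p v ^ m u \<le> \<rho> ^ (m u - m v) * (p u ^ m u * p v ^ m v)"
    by (simp add: power_mult_distrib mult_ac)
  have "multi_term k p r (m \<circ> ?\<tau>) = multinomial k r m * ?R * (p u ^ m v * p v ^ m u)"
    unfolding multi_term_def mult by (subst split) (simp only: R, simp)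
  also have "\<dots> \<le> multinomial k r m * ?R * (\<rho> ^ (m u - m v) * (p u ^ m u * p v ^ m v))"
    using * nn by (intro mult_left_mono mult_nonneg_nonneg multinomial_nonneg prod_nonneg) auto
  also have "\<dots> = \<rho> ^ (m u - m v) * multi_term k p r m"
    unfolding multi_term_def by (subst split) simp
  finally show ?thesis .
qed

text \<open>The win with the largest margin. Its term supplies both the lower bound on
  \<open>win_sum\<close> and the gain in \<open>win_sum_ratio\<close>.\<close>

lemma unanimous_vote:
  assumes "u \<in> {1..k}" "1 \<le> r"
  shows "(\<lambda>j. if j = u then r else 0) \<in> winning k u r"
    "multi_term k p r (\<lambda>j. if j = u then r else 0) = p u ^ r"
proof -
  show "(\<lambda>j. if j = u then r else 0) \<in> winning k u r"
    using assms by (auto simp: winning_def)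
  have "(\<Prod>j=1..k. fact (if j = u then r else 0)) = (\<Prod>j=1..k. if j = u then fact r else (1::real))"
    "(\<Prod>j=1..k. p j ^ (if j = u then r else 0)) = (\<Prod>j=1..k. if j = u then p u ^ r else 1)"
    by (intro prod.cong; simp)+
  then show "multi_term k p r (\<lambda>j. if j = u then r else 0) = p u ^ r"
    using assms by (simp add: multi_term_def multinomial_def)
qed

lemma win_sum_ge_power:
  assumes "u \<in> {1..k}" "1 \<le> r" "\<forall>j\<in>{1..k}. 0 \<le> p j"
  shows "p u ^ r \<le> win_sum k u r p"
proof -
  have "multi_term k p r (\<lambda>j. if j = u then r else 0) \<le> win_sum k u r p"
    unfolding win_sum_def
    by (intro member_le_sum unanimous_vote finite_winning multi_term_nonneg assms)
  then show ?thesis using unanimous_vote(2)[OF assms(1,2)] by simp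
qed

text \<open>Each winning margin is at least 1 and costs at least one factor \<open>\<rho>\<close>.
  The unanimous vote has margin \<open>r\<close>; for \<open>r \<ge> 2\<close> it costs at least
  \<open>\<rho> ^ 2\<close>, which saves \<open>\<rho> - \<rho> ^ 2 = \<rho> * (1 - \<rho>)\<close>
  times its term.\<close>

lemma win_sum_ratio:
  assumes uv: "u \<in> {1..k}" "v \<in> {1..k}" "u \<noteq> v"
    and nn: "\<forall>j\<in>{1..k}. 0 \<le> p j"
    and \<rho>: "0 \<le> \<rho>" "\<rho> \<le> 1" "p v \<le> \<rho> * p u"
  shows "win_sum k v r p \<le> \<rho> * win_sum k u r p"
    and "2 \<le> r \<Longrightarrow> win_sum k v r p + \<rho> * (1 - \<rho>) * p u ^ r \<le> \<rho> * win_sum k u r p"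
proof -
  let ?\<tau> = "Transposition.transpose u v"
  let ?e = "\<lambda>j. if j = u then r else 0"
  have inj: "inj_on (\<lambda>m. m \<circ> ?\<tau>) (winning k u r)"
    by (rule inj_on_inverseI[where g = "\<lambda>m. m \<circ> ?\<tau>"]) (auto simp: fun_eq_iff)
  have swap: "win_sum k v r p = (\<Sum>m\<in>winning k u r. multi_term k p r (m \<circ> ?\<tau>))"
    unfolding win_sum_def winning_transpose[OF uv(1,2)] by (subst sum.reindex[OF inj]) simp
  have term_le: "multi_term k p r (m \<circ> ?\<tau>) \<le> \<rho> * multi_term k p r m" if "m \<in> winning k u r" for m
  proof -
    have less: "m v < m u" using that uv by (auto simp: winning_def)
    have "multi_term k p r (m \<circ> ?\<tau>) \<le> \<rho> ^ (m u - m v) * multi_term k p r m"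
      using less by (intro multi_term_transpose_le assms) auto
    also have "\<dots> \<le> \<rho> ^ 1 * multi_term k p r m"
      using less \<rho> by (intro mult_right_mono power_decreasing multi_term_nonneg nn) auto
    finally show ?thesis by simp
  qed
  then show "win_sum k v r p \<le> \<rho> * win_sum k u r p"
    unfolding swap by (simp add: win_sum_def sum_distrib_left sum_mono)
  assume r: "2 \<le> r"
  have e: "?e \<in> winning k u r" "multi_term k p r ?e = p u ^ r"
    using unanimous_vote[of u k r] uv r by auto
  have "multi_term k p r (?e \<circ> ?\<tau>) \<le> \<rho> ^ r * p u ^ r"
    using multi_term_transpose_le[OF uv nn \<rho>(1,3), of ?e r] e(2) uv by simp
  also have "\<dots> \<le> \<rho> ^ 2 * p u ^ r"
    using r \<rho> nn uv by (intro mult_right_mono power_decreasing) auto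
  finally have e_le: "multi_term k p r (?e \<circ> ?\<tau>) + \<rho> * (1 - \<rho>) * p u ^ r \<le> \<rho> * multi_term k p r ?e"
    using e(2) by (simp add: power2_eq_square algebra_simps)
  have "win_sum k v r p + \<rho> * (1 - \<rho>) * p u ^ r =
      (\<Sum>m\<in>winning k u r. multi_term k p r (m \<circ> ?\<tau>) + (if m = ?e then \<rho> * (1 - \<rho>) * p u ^ r else 0))"
    using e(1) by (simp add: swap sum.distrib finite_winning)
  also have "\<dots> \<le> (\<Sum>m\<in>winning k u r. \<rho> * multi_term k p r m)"
    using e_le term_le by (intro sum_mono) auto
  finally show "win_sum k v r p + \<rho> * (1 - \<rho>) * p u ^ r \<le> \<rho> * win_sum k u r p"
    by (simp add: win_sum_def sum_distrib_left)
qed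

lemma win_prob_ratio:
  assumes uv: "u \<in> {1..k}" "v \<in> {1..k}" "u \<noteq> v"
    and p: "p \<in> prob_vectors k"
    and \<rho>: "0 \<le> \<rho>" "\<rho> \<le> 1" "p v \<le> \<rho> * p u" and n: "2 \<le> n"
  shows "win_prob k v n p + \<rho> * (1 - \<rho>) * p u ^ n \<le> \<rho> * win_prob k u n p"
proof -
  note nn = prob_vectorsD(3)[OF p]
  let ?w = "\<lambda>m0. real (n choose m0) * p 0 ^ m0"
  \<comment> \<open>The gain is booked on the summand \<open>m0 = 0\<close>, where all
    \<open>n \<ge> 2\<close> voters take part; the other summands use the plain ratio bound.\<close>
  have "win_prob k v n p + \<rho> * (1 - \<rho>) * p u ^ n =
     (\<Sum>m0=0..n-1. ?w m0 * (win_sum k v (n - m0) p + (if m0 = 0 then \<rho> * (1 - \<rho>) * p u ^ n else 0)))"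
    by (simp add: win_prob_def distrib_left sum.distrib if_distrib[of "(*) _"] cong: if_cong)
  also have "\<dots> \<le> (\<Sum>m0=0..n-1. ?w m0 * (\<rho> * win_sum k u (n - m0) p))"
    using win_sum_ratio[OF uv nn \<rho>] n prob_vectorsD(1)[OF p, of 0]
    by (intro sum_mono mult_left_mono) auto
  also have "\<dots> = \<rho> * win_prob k u n p"
    by (simp add: win_prob_def sum_distrib_left mult_ac)
  finally show ?thesis .
qed

text \<open>Two ways to win: all voters choose \<open>u\<close>, or all but one abstain and the
  remaining one chooses \<open>u\<close>. The second is the effective bound when \<open>p 0\<close>
  is close to 1.\<close>

lemma win_prob_ge:
  assumes u: "u \<in> {1..k}" and p: "p \<in> prob_vectors k" and n: "1 \<le> n"
  shows "p u ^ n \<le> win_prob k u n p"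
    and "real n * p 0 ^ (n - 1) * p u \<le> win_prob k u n p"
proof -
  note nn = prob_vectorsD(3)[OF p]
  let ?t = "\<lambda>m0. real (n choose m0) * p 0 ^ m0 * win_sum k u (n - m0) p"
  have le: "?t m0 \<le> win_prob k u n p" if "m0 \<in> {0..n-1}" for m0
    unfolding win_prob_def using that prob_vectorsD(1)[OF p, of 0]
    by (intro member_le_sum mult_nonneg_nonneg win_sum_nonneg nn) auto
  show "p u ^ n \<le> win_prob k u n p"
    using le[of 0] win_sum_ge_power[OF u n nn] by simp
  have "real (n choose (n - 1)) = real n"
    using n by (subst binomial_symmetric) auto
  then have "real n * p 0 ^ (n - 1) * p u \<le> ?t (n - 1)"
    using win_sum_ge_power[OF u _ nn, of 1] n prob_vectorsD(1)[OF p, of 0] by (simp add: mult_left_mono)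
  then show "real n * p 0 ^ (n - 1) * p u \<le> win_prob k u n p"
    using le[of "n - 1"] by simp
qed

section \<open>Continuity of the winning probabilities\<close>

text \<open>On factors of absolute value at most 1, a product is 1-Lipschitz in each factor and the
  power \<open>e j\<close> is Lipschitz with constant \<open>e j\<close>.\<close>

lemma tendsto_prod_power_diff:
  fixes p p' :: "nat \<Rightarrow> nat \<Rightarrow> real"
  assumes bd: "\<And>t j. j \<le> k \<Longrightarrow> \<bar>p t j\<bar> \<le> 1" "\<And>t j. j \<le> k \<Longrightarrow> \<bar>p' t j\<bar> \<le> 1"
    and lim: "\<And>j. j \<le> k \<Longrightarrow> (\<lambda>t. p t j - p' t j) \<longlonglongrightarrow> 0"
  shows "(\<lambda>t. (\<Prod>j\<le>k. p t j ^ e j) - (\<Prod>j\<le>k. p' t j ^ e j)) \<longlonglongrightarrow> 0"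
proof (rule tendsto_0_le[where K = 1])
  show "(\<lambda>t. \<Sum>j\<le>k. real (e j) * \<bar>p t j - p' t j\<bar>) \<longlonglongrightarrow> 0"
    by (intro tendsto_null_sum tendsto_mult_right_zero tendsto_rabs_zero lim) auto
  show "\<forall>\<^sub>F t in sequentially. norm ((\<Prod>j\<le>k. p t j ^ e j) - (\<Prod>j\<le>k. p' t j ^ e j))
      \<le> norm (\<Sum>j\<le>k. real (e j) * \<bar>p t j - p' t j\<bar>) * 1"
  proof (rule always_eventually, rule allI)
    fix t
    have "norm ((\<Prod>j\<le>k. p t j ^ e j) - (\<Prod>j\<le>k. p' t j ^ e j))
        \<le> (\<Sum>j\<le>k. norm (p t j ^ e j - p' t j ^ e j))"
      by (rule norm_prod_diff) (auto simp: power_abs intro!: power_le_one bd)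
    also have "\<dots> \<le> (\<Sum>j\<le>k. real (e j) * \<bar>p t j - p' t j\<bar>)"
      using bd norm_power_diff[of "p t _" "p' t _"] by (intro sum_mono) auto
    finally show "norm ((\<Prod>j\<le>k. p t j ^ e j) - (\<Prod>j\<le>k. p' t j ^ e j))
      \<le> norm (\<Sum>j\<le>k. real (e j) * \<bar>p t j - p' t j\<bar>) * 1" by simp
  qed
qed

text \<open>The slot at index 0 of \<open>m\<close> carries the number of abstentions, which
  exhibits a polynomial in \<open>p 0\<close>, ..., \<open>p k\<close>.\<close>

lemma win_prob_monomials:
  "win_prob k i n p = (\<Sum>m0=0..n-1. \<Sum>m\<in>winning k i (n - m0).
    real (n choose m0) * multinomial k (n - m0) m * (\<Prod>j\<le>k. p j ^ (m(0 := m0)) j))"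
proof -
  have "(\<Prod>j\<le>k. p j ^ (m(0 := m0)) j) = p 0 ^ m0 * (\<Prod>j=1..k. p j ^ m j)" for m m0
  proof -
    have "{..k} = insert 0 {1..k}" by auto
    then show ?thesis by simp
  qed
  then show ?thesis
    by (simp add: win_prob_def win_sum_def multi_term_def sum_distrib_left mult_ac)
qed

lemma tendsto_win_prob_diff:
  assumes "\<And>t. p t \<in> prob_vectors k" "\<And>t. p' t \<in> prob_vectors k"
    and "\<And>j. j \<le> k \<Longrightarrow> (\<lambda>t. p t j - p' t j) \<longlonglongrightarrow> 0"
  shows "(\<lambda>t. win_prob k i n (p t) - win_prob k i n (p' t)) \<longlonglongrightarrow> 0"
proof -
  have bd: "j \<le> k \<Longrightarrow> \<bar>p t j\<bar> \<le> 1" "j \<le> k \<Longrightarrow> \<bar>p' t j\<bar> \<le> 1" for t j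
    using prob_vectorsD(1,2)[OF assms(1)] prob_vectorsD(1,2)[OF assms(2)] by auto
  show ?thesis
    unfolding win_prob_monomials sum_subtractf[symmetric] right_diff_distrib[symmetric]
    by (intro tendsto_null_sum tendsto_mult_right_zero tendsto_prod_power_diff bd assms(3))
qed

section \<open>Tied vectors and the one-dimensional map\<close>

lemma tied_vector_prob_vectors:
  assumes "1 \<le> i" "i \<le> k" "y \<in> {0..1 / real i}"
  shows "tied_vector i y \<in> prob_vectors k"
proof -
  have "(\<Sum>j\<le>k. tied_vector i y j) = (\<Sum>j\<le>i. tied_vector i y j)"
    using assms by (intro sum.mono_neutral_right) (auto simp: tied_vector_def)
  also have "{..i} = insert 0 {1..i}" by auto
  then have "(\<Sum>j\<le>i. tied_vector i y j) = tied_vector i y 0 + (\<Sum>j=1..i. tied_vector i y j)"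
    by simp
  also have "(\<Sum>j=1..i. tied_vector i y j) = (\<Sum>j=1..i. y)"
    by (intro sum.cong) (auto simp: tied_vector_def)
  finally have "(\<Sum>j\<le>k. tied_vector i y j) = 1" by (simp add: tied_vector_def)
  moreover have "real i * y \<le> 1" using assms by (simp add: field_simps)
  ultimately show ?thesis using assms by (auto simp: prob_vectors_def tied_vector_def)
qed

text \<open>Count vectors with a vote beyond \<open>i\<close> contribute 0. The others are wins
  among \<open>i\<close> candidates; here \<open>1 \<le> r\<close> forces \<open>m 1 > 0\<close>, so
  that the candidates beyond \<open>i\<close>, who get no votes, do lose.\<close>

lemma win_sum_tied:
  assumes "1 \<le> i" "i \<le> k" "1 \<le> r"
  shows "win_sum k 1 r (tied_vector i y) = (\<Sum>m\<in>winning i 1 r. multinomial i r m * y ^ r)"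
proof -
  have sub: "winning i 1 r \<subseteq> winning k 1 r"
  proof
    fix m assume m: "m \<in> winning i 1 r"
    have zero: "m j = 0" if "j \<notin> {1..i}" for j using m that by (auto simp: winning_def)
    have "m 1 \<noteq> 0"
    proof
      assume "m 1 = 0"
      then have "m j = 0" if "j \<in> {1..i}" for j using m that by (cases "j = 1") (auto simp: winning_def)
      then have "(\<Sum>j=1..i. m j) = 0" by simp
      then show False using m \<open>1 \<le> r\<close> by (auto simp: winning_def)
    qed
    have "(\<Sum>j=1..k. m j) = (\<Sum>j=1..i. m j)"
      using assms zero by (intro sum.mono_neutral_right) auto
    moreover have "m j < m 1" if "j \<in> {1..k}" "j \<noteq> 1" for j
      using m that zero[of j] \<open>m 1 \<noteq> 0\<close> by (cases "j \<in> {1..i}") (auto simp: winning_def)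
    ultimately show "m \<in> winning k 1 r"
      using m assms zero by (auto simp: winning_def)
  qed
  have "win_sum k 1 r (tied_vector i y) =
      (\<Sum>m\<in>winning i 1 r. multi_term k (tied_vector i y) r m)"
    unfolding win_sum_def
  proof (rule sum.mono_neutral_right[OF finite_winning sub], rule ballI)
    fix m assume m: "m \<in> winning k 1 r - winning i 1 r"
    have "\<exists>j\<in>{1..k}. i < j \<and> m j \<noteq> 0"
    proof (rule ccontr)
      assume "\<not> ?thesis"
      then have zero: "m j = 0" if "j \<notin> {1..i}" for j
        using m that by (cases "j \<in> {1..k}") (auto simp: winning_def)
      then have "(\<Sum>j=1..k. m j) = (\<Sum>j=1..i. m j)"
        using assms by (intro sum.mono_neutral_right) auto
      then have "m \<in> winning i 1 r" using m zero assms by (auto simp: winning_def)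
      with m show False by simp
    qed
    then obtain j where "j \<in> {1..k}" "i < j" "m j \<noteq> 0" by auto
    then have "(\<Prod>j=1..k. tied_vector i y j ^ m j) = 0"
      by (intro prod_zero bexI[of _ j]) (auto simp: tied_vector_def)
    then show "multi_term k (tied_vector i y) r m = 0" by (simp add: multi_term_def)
  qed
  also have "\<dots> = (\<Sum>m\<in>winning i 1 r. multinomial i r m * y ^ r)"
  proof (intro sum.cong refl)
    fix m assume m: "m \<in> winning i 1 r"
    have "(\<Prod>j=1..k. fact (m j)) = (\<Prod>j=1..i. fact (m j) :: real)"
      using assms m by (intro prod.mono_neutral_right) (auto simp: winning_def)
    moreover have "(\<Prod>j=1..k. tied_vector i y j ^ m j) = (\<Prod>j=1..i. tied_vector i y j ^ m j)"
      using assms m by (intro prod.mono_neutral_right) (auto simp: winning_def)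
    moreover have "\<dots> = (\<Prod>j=1..i. y ^ m j)"
      by (intro prod.cong) (auto simp: tied_vector_def)
    moreover have "\<dots> = y ^ r"
      using m by (simp add: winning_def power_sum[symmetric])
    ultimately show "multi_term k (tied_vector i y) r m = multinomial i r m * y ^ r"
      by (simp add: multi_term_def multinomial_def)
  qed
  finally show ?thesis .
qed

lemma H_comp_eq_win_prob: "H_comp q k i p = (\<Sum>\<^sub>\<infinity>n\<in>{2..}. pmf q n * win_prob k i n p)"
  by (simp add: H_comp_def win_prob_def win_sum_def multi_term_def)

lemma H_comp_tied_1:
  assumes "1 \<le> i" "i \<le> k"
  shows "H_comp q k 1 (tied_vector i y) = h q i y"
proof -
  have "win_prob k 1 n (tied_vector i y) =
      (\<Sum>m0=0..n-1. real (n choose m0) * (1 - real i * y) ^ m0 *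
        (\<Sum>m\<in>winning i 1 (n - m0). multinomial i (n - m0) m * y ^ (n - m0)))" if "2 \<le> n" for n
    unfolding win_prob_def
    using that assms by (intro sum.cong refl arg_cong2[where f = "(*)"] win_sum_tied)
      (auto simp: tied_vector_def)
  then show ?thesis
    unfolding H_comp_eq_win_prob h_def by (intro infsum_cong) auto
qed

section \<open>Plurality votes with a random number of voters\<close>

lemma Qspace_antimono:
  assumes "p \<in> Qspace k" "1 \<le> a" "a \<le> b" "b \<le> k"
  shows "p b \<le> p a"
  using assms(3,4)
proof (induction b rule: dec_induct)
  case (step n)
  then have "p (Suc n) \<le> p n" using assms(1,2) by (auto simp: Qspace_def)
  then show ?case using step by simp
qed simp

lemma Pspace_prob_vectors: "p \<in> Pspace k \<Longrightarrow> p \<in> prob_vectors k"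
  by (auto simp: Pspace_def prob_vectors_def)

lemma Qspace_tiedD:
  assumes p: "p \<in> Qspace_tied k i" and i: "1 \<le> i" "i \<le> k"
  shows "p \<in> prob_vectors k" "\<And>j. j \<in> {1..i} \<Longrightarrow> p j = p 1" "\<And>j. j \<in> {1..k} \<Longrightarrow> p j \<le> p 1"
    "\<And>j. j \<in> {Suc i..k} \<Longrightarrow> p j \<le> p (Suc i)" "i < k \<Longrightarrow> p (Suc i) < p 1"
    "0 < p 1" "p 1 \<le> 1 / real i" "\<And>j. k < j \<Longrightarrow> p j = 0"
    "1 - p 0 \<le> real k * p 1"
proof -
  have Q: "p \<in> Qspace k" and P: "p \<in> Pspace k"
    using p by (auto simp: Qspace_tied_def Qspace_def)
  show pv: "p \<in> prob_vectors k" by (rule Pspace_prob_vectors[OF P])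
  show tied: "p j = p 1" if "j \<in> {1..i}" for j
    using p that unfolding Qspace_tied_def by blast
  show le: "p j \<le> p 1" if "j \<in> {1..k}" for j
    using that by (intro Qspace_antimono[OF Q]) simp_all
  show "p j \<le> p (Suc i)" if "j \<in> {Suc i..k}" for j
    using that by (intro Qspace_antimono[OF Q]) simp_all
  show "p (Suc i) < p 1" if "i < k"
  proof -
    have "p (Suc i) < p i" using p that unfolding Qspace_tied_def by blast
    also have "p i = p 1" using i by (intro tied) simp
    finally show ?thesis .
  qed
  show "p j = 0" if "k < j" for j using P that by (auto simp: Pspace_def)
  note sum = prob_vectorsD(4)[OF pv]
  \<comment> \<open>As \<open>p 1\<close> is the largest share among the candidates, it controls the
    distance from \<open>p 0 = 1\<close>; in particular \<open>p 0 < 1\<close> forces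
    \<open>p 1 > 0\<close>.\<close>
  have "(\<Sum>j=1..k. p j) \<le> (\<Sum>j=1..k. p 1)" by (intro sum_mono le)
  then show bound: "1 - p 0 \<le> real k * p 1" using sum by simp
  have "p 0 < 1" using P by (simp add: Pspace_def)
  then have "0 < real k * p 1" using bound by linarith
  then show "0 < p 1" using i by (simp add: zero_less_mult_iff)
  have "(\<Sum>j=1..i. p 1) = (\<Sum>j=1..i. p j)" by (intro sum.cong refl tied[symmetric])
  also have "\<dots> \<le> (\<Sum>j=1..k. p j)"
    using i prob_vectorsD(1)[OF pv] by (intro sum_mono2) auto
  also have "\<dots> \<le> 1" using sum prob_vectorsD(1)[OF pv, of 0] by simp
  finally show "p 1 \<le> 1 / real i" using i by (simp add: field_simps)
qed

lemma tied_vector_Qspace_tied: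
  assumes i: "1 \<le> i" "i \<le> k" and y: "y \<in> {0<..1 / real i}"
  shows "tied_vector i y \<in> Qspace_tied k i"
proof -
  have "tied_vector i y \<in> prob_vectors k" using assms by (intro tied_vector_prob_vectors) auto
  then show ?thesis
    using assms by (auto simp: Qspace_tied_def Qspace_def Pspace_def prob_vectors_def tied_vector_def)
qed

section \<open>Expectations over the number of voters\<close>

locale plurality =
  fixes q :: "nat pmf"
  assumes two_le: "n \<in> set_pmf q \<Longrightarrow> 2 \<le> n"
begin

text \<open>The probability generating function \<open>G\<close> of \<open>q\<close>: the
  probability that every voter makes a given choice of probability \<open>x\<close>.\<close>

definition power_mean :: "real \<Rightarrow> real"
  where "power_mean x = measure_pmf.expectation q (\<lambda>n. x ^ n)"

lemma expectation_mono:
  assumes "integrable (measure_pmf q) f" "integrable (measure_pmf q) g"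
    and "\<And>n. 2 \<le> n \<Longrightarrow> f n \<le> (g n :: real)"
  shows "measure_pmf.expectation q f \<le> measure_pmf.expectation q g"
  using assms two_le by (intro integral_mono_AE) (auto simp: AE_measure_pmf_iff)

lemma integrable_win_prob:
  assumes "p \<in> prob_vectors k" "i \<in> {1..k}"
  shows "integrable (measure_pmf q) (\<lambda>n. win_prob k i n p)"
  by (rule measure_pmf.integrable_const_bound[where B = 1])
    (use win_prob_nonneg[OF assms(1)] win_prob_le_1[OF assms] in auto)

lemma integrable_power:
  assumes "0 \<le> x" "x \<le> (1::real)"
  shows "integrable (measure_pmf q) (\<lambda>n. x ^ n)"
  by (rule measure_pmf.integrable_const_bound[where B = 1]) (use assms in \<open>auto intro: power_le_one\<close>)

text \<open>As \<open>q\<close> has no mass below 2, the sum over \<open>{2..}\<close> is a full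
  expectation, to which monotonicity of the integral and dominated convergence apply.\<close>

lemma H_comp_expectation:
  assumes "p \<in> prob_vectors k" "i \<in> {1..k}"
  shows "H_comp q k i p = measure_pmf.expectation q (\<lambda>n. win_prob k i n p)"
proof -
  have zero: "pmf q n = 0" if "\<not> 2 \<le> n" for n
    using two_le[of n] that by (auto simp: set_pmf_iff)
  have "Infinite_Set_Sum.abs_summable_on (\<lambda>n. pmf q n * win_prob k i n p) UNIV"
  proof (rule abs_summable_on_comparison_test[OF pmf_abs_summable[of q UNIV]])
    fix n
    show "norm (pmf q n * win_prob k i n p) \<le> norm (pmf q n)"
      using win_prob_nonneg[OF assms(1)] win_prob_le_1[OF assms]
      by (simp add: abs_mult mult_left_le)
  qed
  then have "measure_pmf.expectation q (\<lambda>n. win_prob k i n p) =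
      (\<Sum>\<^sub>\<infinity>n\<in>UNIV. pmf q n * win_prob k i n p)"
    by (simp add: pmf_expectation_eq_infsetsum infsetsum_infsum)
  also have "\<dots> = H_comp q k i p"
    unfolding H_comp_eq_win_prob by (rule infsum_cong_neutral) (auto simp: zero)
  finally show ?thesis by simp
qed

lemma power_mean_ge:
  assumes "0 \<le> x" "x \<le> 1"
  shows "pmf q n * x ^ n \<le> power_mean x"
proof -
  have "pmf q n * x ^ n = measure_pmf.expectation q (\<lambda>m. indicator {n} m * x ^ n)"
    by (simp add: measure_pmf_single)
  also have "\<dots> \<le> power_mean x"
    unfolding power_mean_def
  proof (rule expectation_mono[OF _ integrable_power[OF assms]])
    show "integrable (measure_pmf q) (\<lambda>m. indicator {n} m * x ^ n)"
      by (rule measure_pmf.integrable_const_bound[where B = 1])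
        (use assms in \<open>auto simp: indicator_def intro: power_le_one\<close>)
  qed (use assms in \<open>auto simp: indicator_def\<close>)
  finally show ?thesis .
qed

lemma power_mean_nonneg: "0 \<le> x \<Longrightarrow> 0 \<le> power_mean x"
  unfolding power_mean_def by simp

lemma power_mean_pos:
  assumes "0 < x" "x \<le> 1"
  shows "0 < power_mean x"
proof -
  obtain n where "n \<in> set_pmf q" using set_pmf_not_empty[of q] by blast
  then have "0 < pmf q n * x ^ n" using assms by (simp add: pmf_positive)
  with power_mean_ge[of x n] assms show ?thesis by simp
qed

lemma power_mean_le_1:
  assumes "0 \<le> x" "x \<le> 1"
  shows "power_mean x \<le> 1"
proof -
  have "power_mean x \<le> measure_pmf.expectation q (\<lambda>n. 1)"
    unfolding power_mean_def
    by (intro expectation_mono integrable_power) (use assms in \<open>auto intro: power_le_one\<close>)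
  then show ?thesis by simp
qed

lemma power_mean_mono:
  assumes "0 \<le> x" "x \<le> y" "y \<le> 1"
  shows "power_mean x \<le> power_mean y"
  unfolding power_mean_def
  by (intro expectation_mono integrable_power power_mono) (use assms in auto)

lemma H_comp_nonneg:
  assumes "p \<in> prob_vectors k" "i \<in> {1..k}"
  shows "0 \<le> H_comp q k i p"
  by (simp add: H_comp_expectation[OF assms] win_prob_nonneg[OF assms(1)])

lemma sum_H_comp_le_1:
  assumes "p \<in> prob_vectors k"
  shows "(\<Sum>i=1..k. H_comp q k i p) \<le> 1"
proof -
  have "(\<Sum>i=1..k. H_comp q k i p) = measure_pmf.expectation q (\<lambda>n. \<Sum>i=1..k. win_prob k i n p)"
    by (simp add: H_comp_expectation[OF assms] Bochner_Integration.integral_sum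
        integrable_win_prob[OF assms])
  also have "\<dots> \<le> measure_pmf.expectation q (\<lambda>n. 1)"
    by (intro expectation_mono Bochner_Integration.integrable_sum integrable_win_prob assms
        sum_win_prob_le_1) auto
  finally show ?thesis by simp
qed

lemma H_comp_ge_power_mean:
  assumes "p \<in> prob_vectors k" "u \<in> {1..k}"
  shows "power_mean (p u) \<le> H_comp q k u p"
  unfolding H_comp_expectation[OF assms] power_mean_def
  by (intro expectation_mono integrable_power integrable_win_prob win_prob_ge)
    (use assms prob_vectorsD(1,2)[OF assms(1)] in auto)

text \<open>The expectation of \<open>win_prob_ratio\<close>. The case \<open>\<rho> = 1\<close>
  gives monotonicity, \<open>\<rho> = 0\<close> shows that a candidate of probability 0 never wins,
  and \<open>0 < \<rho> < 1\<close> drives the decay of ratios.\<close>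

lemma H_comp_ratio:
  assumes "u \<in> {1..k}" "v \<in> {1..k}" "u \<noteq> v" and p: "p \<in> prob_vectors k"
    and "0 \<le> \<rho>" "\<rho> \<le> 1" "p v \<le> \<rho> * p u"
  shows "H_comp q k v p + \<rho> * (1 - \<rho>) * power_mean (p u) \<le> \<rho> * H_comp q k u p"
proof -
  note int = integrable_win_prob[OF p]
  have int': "integrable (measure_pmf q) (\<lambda>n. \<rho> * (1 - \<rho>) * p u ^ n)"
    using assms prob_vectorsD(1,2)[OF p] by (intro integrable_mult_right integrable_power) auto
  have "H_comp q k v p + \<rho> * (1 - \<rho>) * power_mean (p u) =
      measure_pmf.expectation q (\<lambda>n. win_prob k v n p + \<rho> * (1 - \<rho>) * p u ^ n)"
    using assms int int' by (simp add: H_comp_expectation power_mean_def)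
  also have "\<dots> \<le> measure_pmf.expectation q (\<lambda>n. \<rho> * win_prob k u n p)"
    using assms by (intro expectation_mono Bochner_Integration.integrable_add int int'
        integrable_mult_right win_prob_ratio) auto
  also have "\<dots> = \<rho> * H_comp q k u p"
    using assms by (simp add: H_comp_expectation)
  finally show ?thesis .
qed

lemma H_comp_mono:
  assumes "u \<in> {1..k}" "v \<in> {1..k}" "p \<in> prob_vectors k" "p v \<le> p u"
  shows "H_comp q k v p \<le> H_comp q k u p"
  using H_comp_ratio[of u k v p 1] assms by (cases "u = v") auto

lemma H_comp_ge_linear:
  assumes int: "integrable (measure_pmf q) (\<lambda>N. real N * (real N - 1))"
    and p: "p \<in> prob_vectors k" and u: "u \<in> {1..k}"
  shows "(2 - measure_pmf.expectation q (\<lambda>N. real N * (real N - 1)) * (1 - p 0)) * p u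
    \<le> H_comp q k u p"
proof -
  let ?G = "measure_pmf.expectation q (\<lambda>N. real N * (real N - 1))"
  note nn = prob_vectorsD(1,2)[OF p]
  have "(2 - ?G * (1 - p 0)) * p u =
      measure_pmf.expectation q (\<lambda>n. (2 - real n * (real n - 1) * (1 - p 0)) * p u)"
    using int by simp
  also have "\<dots> \<le> measure_pmf.expectation q (\<lambda>n. win_prob k u n p)"
  proof (rule expectation_mono[OF _ integrable_win_prob[OF p u]])
    show "integrable (measure_pmf q) (\<lambda>n. (2 - real n * (real n - 1) * (1 - p 0)) * p u)"
      using int by simp
    fix n :: nat assume n: "2 \<le> n"
    have "1 + real (n - 1) * (p 0 - 1) \<le> (1 + (p 0 - 1)) ^ (n - 1)"
      using nn[of 0] by (intro Bernoulli_inequality) auto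
    then have "real n * (1 + (real n - 1) * (p 0 - 1)) \<le> real n * p 0 ^ (n - 1)"
      using n by (intro mult_left_mono) (auto simp: of_nat_diff)
    moreover have "2 \<le> real n" using n by simp
    ultimately have "2 - real n * (real n - 1) * (1 - p 0) \<le> real n * p 0 ^ (n - 1)"
      by (simp add: algebra_simps)
    then have "(2 - real n * (real n - 1) * (1 - p 0)) * p u \<le> real n * p 0 ^ (n - 1) * p u"
      using nn u by (intro mult_right_mono) auto
    also have "\<dots> \<le> win_prob k u n p" using n by (intro win_prob_ge u p) auto
    finally show "(2 - real n * (real n - 1) * (1 - p 0)) * p u \<le> win_prob k u n p" .
  qed
  also have "\<dots> = H_comp q k u p" by (simp only: H_comp_expectation[OF p u])
  finally show ?thesis .
qed

section \<open>Continuity of the maps\<close>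

text \<open>Stated for differences because it will compare an orbit with its tied approximation
  before either is known to converge.\<close>

lemma tendsto_H_comp_diff:
  assumes p: "\<And>t. p t \<in> prob_vectors k" "\<And>t. p' t \<in> prob_vectors k"
    and i: "i \<in> {1..k}"
    and lim: "\<And>j. j \<le> k \<Longrightarrow> (\<lambda>t. p t j - p' t j) \<longlonglongrightarrow> 0"
  shows "(\<lambda>t. H_comp q k i (p t) - H_comp q k i (p' t)) \<longlonglongrightarrow> 0"
proof -
  have "(\<lambda>t. measure_pmf.expectation q (\<lambda>n. win_prob k i n (p t) - win_prob k i n (p' t)))
      \<longlonglongrightarrow> measure_pmf.expectation q (\<lambda>n. 0)"
  \<comment> \<open>Two probabilities differ by at most 1, so the constant 1 dominates.\<close>
  proof (rule integral_dominated_convergence[where w = "\<lambda>_. 1"])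
    show "AE n in measure_pmf q. norm (win_prob k i n (p t) - win_prob k i n (p' t)) \<le> 1" for t
      using win_prob_nonneg[OF p(1)] win_prob_le_1[OF p(1) i]
        win_prob_nonneg[OF p(2)] win_prob_le_1[OF p(2) i]
      by (intro AE_I2) (smt (verit) real_norm_def)
    show "AE n in measure_pmf q. (\<lambda>t. win_prob k i n (p t) - win_prob k i n (p' t)) \<longlonglongrightarrow> 0"
      by (intro AE_I2 tendsto_win_prob_diff p lim)
  qed auto
  then show ?thesis
    unfolding H_comp_expectation[OF p(1) i] H_comp_expectation[OF p(2) i]
    by (simp add: integrable_win_prob[OF p(1) i] integrable_win_prob[OF p(2) i]
        del: One_nat_def)
qed

text \<open>Candidates \<open>1..i\<close> are equally likely, so monotonicity applies in both
  directions and reduces the claim to candidate 1.\<close>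

lemma H_comp_tied:
  assumes i: "1 \<le> i" "i \<le> k" and j: "j \<in> {1..i}" and y: "y \<in> {0..1 / real i}"
  shows "H_comp q k j (tied_vector i y) = h q i y"
proof -
  note p = tied_vector_prob_vectors[OF i y]
  have "tied_vector i y j = tied_vector i y 1" using i j by (simp add: tied_vector_def)
  then have "H_comp q k j (tied_vector i y) = H_comp q k 1 (tied_vector i y)"
    using i j p by (intro antisym H_comp_mono) auto
  then show ?thesis using H_comp_tied_1[OF i] by simp
qed

lemma continuous_on_h:
  assumes "1 \<le> i"
  shows "continuous_on {0..1 / real i} (h q i)"
proof (rule continuous_on_sequentiallyI)
  fix z y assume z: "\<forall>n. z n \<in> {0..1 / real i}" and y: "y \<in> {0..1 / real i}" and lim: "z \<longlonglongrightarrow> y"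
  have "(\<lambda>t. tied_vector i (z t) j - tied_vector i y j) \<longlonglongrightarrow> 0" for j
  proof -
    have "(\<lambda>t. tied_vector i (z t) j) \<longlonglongrightarrow> tied_vector i y j"
      unfolding tied_vector_def using lim by (auto intro!: tendsto_intros)
    then show ?thesis by (simp add: LIM_zero_iff)
  qed
  then have "(\<lambda>t. H_comp q i 1 (tied_vector i (z t)) - H_comp q i 1 (tied_vector i y)) \<longlonglongrightarrow> 0"
    using z y assms by (intro tendsto_H_comp_diff tied_vector_prob_vectors) auto
  then show "(\<lambda>n. h q i (z n)) \<longlonglongrightarrow> h q i y"
    unfolding H_comp_tied_1[OF assms order_refl] by (rule LIM_zero_cancel)
qed

section \<open>Invariance of the tied region\<close>

text \<open>Monotonicity preserves the order of the coordinates and hence their ties, while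
  \<open>H_comp q k 1 p \<ge> power_mean (p 1) > 0\<close> keeps coordinate 0 below 1.\<close>

lemma H_Qspace_tied:
  assumes p: "p \<in> Qspace_tied k i" and i: "1 \<le> i" "i \<le> k"
  shows "H q k p \<in> Qspace_tied k i"
proof -
  note D = Qspace_tiedD[OF p i]
  have H: "H q k p j = H_comp q k j p" if "j \<in> {1..k}" for j
    using that by (simp add: H_def)
  have H0: "H q k p 0 = 1 - (\<Sum>j=1..k. H q k p j)"
    by (simp add: H_def)
  have nn: "0 \<le> H q k p j" if "j \<in> {1..k}" for j
    using that by (simp add: H H_comp_nonneg[OF D(1)])
  have "p 1 \<le> 1" using i by (intro prob_vectorsD(2)[OF D(1)]) auto
  then have "0 < power_mean (p 1)" by (rule power_mean_pos[OF D(6)])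
  also have "\<dots> \<le> H_comp q k 1 p" using i by (intro H_comp_ge_power_mean D) auto
  finally have pos: "0 < H_comp q k 1 p" .
  have mono: "H q k p b \<le> H q k p a" if "a \<in> {1..k}" "b \<in> {1..k}" "p b \<le> p a" for a b
    using that by (simp add: H H_comp_mono[OF _ _ D(1)])
  have tied: "H q k p j = H q k p 1" if "j \<in> {1..i}" for j
    using that i D(2)[OF that] by (intro antisym mono) auto
  have "(\<Sum>j=1..k. H q k p j) = (\<Sum>j=1..k. H_comp q k j p)"
    by (intro sum.cong refl H)
  then have "0 \<le> H q k p 0" using sum_H_comp_le_1[OF D(1)] H0 by simp
  moreover have "H q k p 1 \<le> (\<Sum>j=1..k. H q k p j)"
    using i nn by (intro member_le_sum) auto
  then have "H q k p 0 < 1" using H0 H[of 1] pos i by simp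
  moreover have "{..k} = insert 0 {1..k}" by auto
  then have "(\<Sum>j\<le>k. H q k p j) = 1" by (simp add: H0)
  ultimately have "H q k p \<in> Pspace k"
    using nn by (auto simp: Pspace_def H_def not_le Suc_le_eq)
  moreover have "p (Suc j) \<le> p j" if "j \<in> {1..<k}" for j
    using p that by (auto simp: Qspace_tied_def Qspace_def)
  then have "H q k p (Suc j) \<le> H q k p j" if "j \<in> {1..<k}" for j
    using that by (intro mono) auto
  moreover have "H q k p (Suc i) < H q k p i" if "i < k"
  proof -
    let ?\<rho> = "p (Suc i) / p 1"
    have \<rho>: "0 \<le> ?\<rho>" "?\<rho> < 1"
      using D(5,6) prob_vectorsD(1)[OF D(1), of "Suc i"] that by auto
    have "H_comp q k (Suc i) p + ?\<rho> * (1 - ?\<rho>) * power_mean (p 1) \<le> ?\<rho> * H_comp q k 1 p"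
      using \<rho> D(6) that i by (intro H_comp_ratio D(1)) auto
    moreover have "0 \<le> ?\<rho> * (1 - ?\<rho>) * power_mean (p 1)"
      using \<rho> \<open>0 < power_mean (p 1)\<close> by (intro mult_nonneg_nonneg) auto
    \<comment> \<open>Strictness comes from \<open>?\<rho> < 1\<close> and a positive leading
      coordinate; the gain term vanishes when \<open>?\<rho> = 0\<close>.\<close>
    moreover have "?\<rho> * H_comp q k 1 p < 1 * H_comp q k 1 p"
      using \<rho> pos by (intro mult_strict_right_mono)
    ultimately have "H_comp q k (Suc i) p < H_comp q k 1 p" by linarith
    then have "H q k p (Suc i) < H q k p 1" using H[of "Suc i"] H[of 1] i that by simp
    then show ?thesis using tied[of i] i by simp
  qed
  ultimately show ?thesis using tied unfolding Qspace_tied_def Qspace_def by blast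
qed

lemma H_iterates_Qspace_tied:
  assumes "p \<in> Qspace_tied k i" "1 \<le> i" "i \<le> k"
  shows "(H q k ^^ t) p \<in> Qspace_tied k i"
  using assms by (induction t) (auto intro: H_Qspace_tied)

section \<open>Growth of the leading coordinate and decay of ratios\<close>

text \<open>Near \<open>p 0 = 1\<close> the linear bound has slope at least 1, so the leading
  coordinate does not decrease; elsewhere \<open>p 1\<close> is bounded below and so is
  \<open>power_mean (p 1)\<close>. The bound \<open>m\<close> is uniform in
  \<open>p\<close>.\<close>

lemma H_1_lower_bound:
  assumes int: "integrable (measure_pmf q) (\<lambda>N. real N * (real N - 1))"
    and i: "1 \<le> i" "i \<le> k"
  obtains m where "0 < m" "\<And>p. p \<in> Qspace_tied k i \<Longrightarrow> min (p 1) m \<le> H q k p 1"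
proof -
  let ?G = "measure_pmf.expectation q (\<lambda>N. real N * (real N - 1))"
  \<comment> \<open>The lower bound on \<open>p 1\<close> that follows from
    \<open>?G * (1 - p 0) > 1\<close> and \<open>1 - p 0 \<le> real k * p 1\<close>.\<close>
  let ?d = "1 / (?G * real k)"
  have "measure_pmf.expectation q (\<lambda>_. 2) \<le> ?G"
  proof (rule expectation_mono[OF _ int])
    fix n :: nat assume "2 \<le> n"
    then have "2 * 1 \<le> real n * (real n - 1)" by (intro mult_mono) auto
    then show "2 \<le> real n * (real n - 1)" by simp
  qed simp
  then have G: "2 \<le> ?G" by simp
  have "1 * 1 \<le> ?G * real k" using G i by (intro mult_mono) auto
  then have d: "0 < ?d" "?d \<le> 1" by auto
  show ?thesis
  proof (rule that[of "power_mean ?d"])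
    show "0 < power_mean ?d" by (rule power_mean_pos[OF d])
    fix p assume p: "p \<in> Qspace_tied k i"
    note D = Qspace_tiedD[OF p i]
    have H: "H q k p 1 = H_comp q k 1 p" using i by (simp add: H_def)
    show "min (p 1) (power_mean ?d) \<le> H q k p 1"
    proof (cases "?G * (1 - p 0) \<le> 1")
      case True
      then have "1 * p 1 \<le> (2 - ?G * (1 - p 0)) * p 1"
        using D(6) by (intro mult_right_mono) auto
      also have "\<dots> \<le> H_comp q k 1 p" using i by (intro H_comp_ge_linear int D) auto
      finally show ?thesis using H by simp
    next
      case False
      have "1 < ?G * (1 - p 0)" using False by simp
      also have "\<dots> \<le> ?G * (real k * p 1)" using D(9) G by (intro mult_left_mono) auto
      finally have "?d \<le> p 1" using d by (simp add: divide_le_eq mult_ac)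
      moreover have "p 1 \<le> 1" using i by (intro prob_vectorsD(2)[OF D(1)]) auto
      ultimately have "power_mean ?d \<le> power_mean (p 1)" using d by (intro power_mean_mono) auto
      also have "\<dots> \<le> H_comp q k 1 p" using i by (intro H_comp_ge_power_mean D) auto
      finally show ?thesis using H by simp
    qed
  qed
qed

text \<open>Because the new leading coordinate is at most 1, the additive gain of
  \<open>H_comp_ratio\<close> dominates a fixed multiple of it and becomes a factor, uniform over
  \<open>p 1 \<ge> c\<close> and ratios up to \<open>\<rho>0\<close>.\<close>

lemma H_ratio_contraction:
  assumes p: "p \<in> Qspace_tied k i" and i: "1 \<le> i" "i < k"
    and c: "0 < c" "c \<le> p 1" and \<rho>: "0 \<le> \<rho>" "\<rho> \<le> \<rho>0" "\<rho>0 < 1" "p (Suc i) \<le> \<rho> * p 1"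
  shows "H q k p (Suc i) \<le> \<rho> * (1 - (1 - \<rho>0) * power_mean c) * H q k p 1"
proof -
  note D = Qspace_tiedD[OF p i(1) less_imp_le[OF i(2)]]
  have H: "H q k p 1 = H_comp q k 1 p" "H q k p (Suc i) = H_comp q k (Suc i) p"
    using i by (simp_all add: H_def)
  have "p 1 \<le> 1" using i by (intro prob_vectorsD(2)[OF D(1)]) auto
  have H1: "0 \<le> H_comp q k 1 p" using i by (intro H_comp_nonneg D) auto
  have "H_comp q k 1 p \<le> (\<Sum>j=1..k. H_comp q k j p)"
    using i by (intro member_le_sum H_comp_nonneg D) auto
  then have "H_comp q k 1 p \<le> 1" using sum_H_comp_le_1[OF D(1)] by simp
  then have "(1 - \<rho>0) * power_mean c * H_comp q k 1 p \<le> (1 - \<rho>) * power_mean (p 1) * 1"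
    using \<rho> c \<open>p 1 \<le> 1\<close> H1
    by (intro mult_mono mult_nonneg_nonneg power_mean_mono power_mean_nonneg) auto
  then have "\<rho> * ((1 - \<rho>0) * power_mean c * H_comp q k 1 p) \<le> \<rho> * ((1 - \<rho>) * power_mean (p 1))"
    using \<rho> by (intro mult_left_mono) auto
  moreover have "H_comp q k (Suc i) p + \<rho> * (1 - \<rho>) * power_mean (p 1) \<le> \<rho> * H_comp q k 1 p"
    using i \<rho> by (intro H_comp_ratio D(1)) auto
  ultimately show ?thesis unfolding H by (simp add: algebra_simps)
qed

lemma H_tied_vector:
  assumes i: "1 \<le> i" "i \<le> k" and y: "y \<in> {0..1 / real i}"
  shows "H q k (tied_vector i y) = tied_vector i (h q i y)"
proof
  let ?p = "tied_vector i y"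
  note p = tied_vector_prob_vectors[OF i y]
  have out: "H_comp q k j ?p = 0" if "j \<in> {1..k}" "i < j" for j
  proof -
    \<comment> \<open>The ratio bound with \<open>\<rho> = 0\<close>, available since
      \<open>?p j = 0\<close>.\<close>
    have "H_comp q k j ?p + 0 * (1 - 0) * power_mean (?p 1) \<le> 0 * H_comp q k 1 ?p"
      using that i by (intro H_comp_ratio p) (auto simp: tied_vector_def)
    then show ?thesis using H_comp_nonneg[OF p that(1)] by simp
  qed
  have "(\<Sum>j=1..k. H_comp q k j ?p) = (\<Sum>j=1..i. H_comp q k j ?p)"
    using i out by (intro sum.mono_neutral_right) auto
  also have "\<dots> = (\<Sum>j=1..i. h q i y)" by (intro sum.cong refl H_comp_tied i y)
  finally have "(\<Sum>j=1..k. H_comp q k j ?p) = real i * h q i y" by simp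
  then show "H q k ?p j = tied_vector i (h q i y) j" for j
    using i out[of j] H_comp_tied[OF i _ y, of j] by (auto simp: H_def tied_vector_def)
qed

section \<open>Location of the fixed point and convergence of orbits\<close>

text \<open>At a fixed point 0 the difference quotient \<open>h q i y / y\<close> would be at least
  \<open>2 - ?G * (real i * y)\<close>, as \<open>1 - p 0 = real i * y\<close> for the tied vector;
  the one-sided derivative would then be at least 2.\<close>

lemma linearly_attracting_pos:
  assumes int: "integrable (measure_pmf q) (\<lambda>N. real N * (real N - 1))"
    and i: "1 \<le> i" and attr: "linearly_attracting (h q i) {0..1 / real i} x"
  shows "0 < x"
proof (rule ccontr)
  assume "\<not> 0 < x"
  let ?G = "measure_pmf.expectation q (\<lambda>N. real N * (real N - 1))"
  have x: "x = 0" and "h q i x = x"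
    using attr \<open>\<not> 0 < x\<close> by (auto simp: linearly_attracting_def is_fixed_point_def)
  obtain D where D: "(h q i has_real_derivative D) (at 0 within {0..1 / real i})" "\<bar>D\<bar> < 1"
    using attr x by (auto simp: linearly_attracting_def)
  have "0 < 1 / real i" using i by simp
  then have at: "at 0 within {0..1 / real i} = at_right 0" by (rule at_within_Icc_at_right)
  have "2 - ?G * (real i * 0) \<le> D"
  proof (rule tendsto_le)
    show "at_right (0::real) \<noteq> bot" by simp
    show "((\<lambda>y. h q i y / y) \<longlongrightarrow> D) (at_right 0)"
      using D(1) x \<open>h q i x = x\<close> unfolding has_field_derivative_iff at by simp
    show "((\<lambda>y. 2 - ?G * (real i * y)) \<longlongrightarrow> 2 - ?G * (real i * 0)) (at_right 0)"
      by (intro tendsto_intros)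
    have "2 - ?G * (real i * y) \<le> h q i y / y" if y: "0 < y" "y < 1 / real i" for y
    proof -
      have "tied_vector i y \<in> prob_vectors i" using y i by (intro tied_vector_prob_vectors) auto
      from H_comp_ge_linear[OF int this, of 1] i
      have "(2 - ?G * (real i * y)) * y \<le> H_comp q i 1 (tied_vector i y)"
        by (simp add: tied_vector_def)
      then show ?thesis
        using y unfolding H_comp_tied_1[OF i order_refl] by (simp add: pos_le_divide_eq)
    qed
    then show "\<forall>\<^sub>F y in at_right 0. 2 - ?G * (real i * y) \<le> h q i y / y"
      unfolding eventually_at_right[OF \<open>0 < 1 / real i\<close>] using \<open>0 < 1 / real i\<close> by blast
  qed
  with D(2) show False by simp
qed

lemma H_orbit_converges:
  assumes int: "integrable (measure_pmf q) (\<lambda>N. real N * (real N - 1))"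
    and i: "1 \<le> i" "i \<le> k"
    and attr: "linearly_attracting (h q i) {0..1 / real i} x"
    and bas: "{0<..1 / real i} \<subseteq> basin (h q i) {0..1 / real i} x"
    and p: "p \<in> Qspace_tied k i"
  shows "(\<lambda>t. (H q k ^^ t) p) \<longlonglongrightarrow> tied_vector i x"
proof -
  define P where "P t = (H q k ^^ t) p" for t
  define X where "X t = P t 1" for t
  have P: "P t \<in> Qspace_tied k i" for t
    unfolding P_def by (rule H_iterates_Qspace_tied[OF p i])
  note D = Qspace_tiedD[OF P i]
  have Suc_P: "P (Suc t) = H q k (P t)" for t by (simp add: P_def)
  obtain m where m: "0 < m" "\<And>p. p \<in> Qspace_tied k i \<Longrightarrow> min (p 1) m \<le> H q k p 1"
    using H_1_lower_bound[OF int i] by blast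
  \<comment> \<open>A lower bound for the whole orbit, so that \<open>{c..1 / real i}\<close> is a
    compact part of the basin avoiding 0.\<close>
  define c where "c = min (X 0) m"
  have c: "0 < c" using D(6)[of 0] m(1) by (simp add: c_def X_def)
  have X_ge: "c \<le> X t" for t
  proof (induction t)
    case (Suc t)
    then show ?case using m(2)[OF P, of t] by (simp add: X_def Suc_P c_def)
  qed (simp add: c_def)
  have X_le: "X t \<le> 1 / real i" for t using D(7) by (simp add: X_def)
  have tail: "(\<lambda>t. P t j) \<longlonglongrightarrow> 0" if j: "j \<in> {Suc i..k}" for j
  proof -
    have "i < k" using j by auto
    define \<rho>0 where "\<rho>0 = P 0 (Suc i) / X 0"
    define \<theta> where "\<theta> = 1 - (1 - \<rho>0) * power_mean c"
    have \<rho>0: "0 \<le> \<rho>0" "\<rho>0 < 1"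
      using D(5,6)[of 0] prob_vectorsD(1)[OF D(1), of "Suc i" 0] \<open>i < k\<close>
      by (auto simp: \<rho>0_def X_def)
    have "X 0 \<le> 1" using i prob_vectorsD(2)[OF D(1), of 1 0] by (simp add: X_def)
    then have "c \<le> 1" using X_ge[of 0] by simp
    then have "0 < power_mean c" "power_mean c \<le> 1"
      using c power_mean_pos power_mean_le_1 by auto
    then have "0 < (1 - \<rho>0) * power_mean c" "(1 - \<rho>0) * power_mean c \<le> 1 * 1"
      using \<rho>0 by (simp, intro mult_mono) auto
    then have \<theta>: "0 \<le> \<theta>" "\<theta> < 1" by (auto simp: \<theta>_def)
    \<comment> \<open>Since \<open>\<rho>0 * \<theta> ^ t \<le> \<rho>0\<close>, the same
      contraction factor \<open>\<theta>\<close> serves at every step.\<close>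
    have ratio: "P t (Suc i) \<le> \<rho>0 * \<theta> ^ t * X t" for t
    proof (induction t)
      case 0
      then show ?case using D(6)[of 0] by (simp add: \<rho>0_def X_def)
    next
      case (Suc t)
      have "\<theta> ^ t \<le> 1" using \<theta> by (intro power_le_one) auto
      then have "\<rho>0 * \<theta> ^ t \<le> \<rho>0" using \<rho>0 by (simp add: mult_left_le)
      then have "H q k (P t) (Suc i) \<le> \<rho>0 * \<theta> ^ t * \<theta> * H q k (P t) 1"
        unfolding \<theta>_def[symmetric] using Suc X_ge[of t] \<rho>0 \<theta> i \<open>i < k\<close> c
        by (subst \<theta>_def, intro H_ratio_contraction P) (auto simp: X_def)
      then show ?case by (simp add: Suc_P X_def mult_ac)
    qed
    show ?thesis
    proof (rule tendsto_sandwich)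
      show "\<forall>\<^sub>F t in sequentially. 0 \<le> P t j"
        using prob_vectorsD(1)[OF D(1)] j by auto
      show "\<forall>\<^sub>F t in sequentially. P t j \<le> \<rho>0 * \<theta> ^ t * 1"
      proof (intro always_eventually allI)
        fix t
        have "P t j \<le> P t (Suc i)" by (rule D(4)[OF j])
        also have "\<dots> \<le> \<rho>0 * \<theta> ^ t * X t" by (rule ratio)
        also have "\<dots> \<le> \<rho>0 * \<theta> ^ t * 1"
          using i \<rho>0 \<theta> prob_vectorsD(2)[OF D(1), of 1 t] by (intro mult_left_mono) (auto simp: X_def)
        finally show "P t j \<le> \<rho>0 * \<theta> ^ t * 1" .
      qed
      have "(\<lambda>t. \<rho>0 * \<theta> ^ t * 1) \<longlonglongrightarrow> \<rho>0 * 0 * 1"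
        using \<theta> by (intro tendsto_intros LIMSEQ_realpow_zero)
      then show "(\<lambda>t. \<rho>0 * \<theta> ^ t * 1) \<longlonglongrightarrow> 0" by simp
    qed simp
  qed
  have diff: "(\<lambda>t. P t j - tied_vector i (X t) j) \<longlonglongrightarrow> 0" for j
  proof -
    consider "j = 0" | "j \<in> {1..i}" | "j \<in> {Suc i..k}" | "k < j" by force
    then show ?thesis
    proof cases
      case 1
      \<comment> \<open>Both vectors have total 1 and agree on \<open>1..i\<close>, so they differ
        at 0 by the mass of the tail.\<close>
      have "P t 0 - tied_vector i (X t) 0 = - (\<Sum>j\<in>{Suc i..k}. P t j)" for t
      proof -
        have "{1..k} = {1..i} \<union> {Suc i..k}" using i by auto
        then have "(\<Sum>j=1..k. P t j) = (\<Sum>j=1..i. P t j) + (\<Sum>j\<in>{Suc i..k}. P t j)"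
          by (simp add: sum.union_disjoint)
        also have "(\<Sum>j=1..i. P t j) = (\<Sum>j=1..i. X t)"
          unfolding X_def by (intro sum.cong refl D(2))
        finally show ?thesis
          using prob_vectorsD(4)[OF D(1), of t] by (simp add: tied_vector_def)
      qed
      moreover have "(\<lambda>t. - (\<Sum>j\<in>{Suc i..k}. P t j)) \<longlonglongrightarrow> - 0"
        by (intro tendsto_minus tendsto_null_sum tail)
      ultimately show ?thesis using 1 by simp
    next
      case 2
      then have "P t j = tied_vector i (X t) j" for t
        using D(2)[OF 2, of t] by (simp add: tied_vector_def X_def)
      then show ?thesis by simp
    next
      case 3
      then show ?thesis using tail[OF 3] by (simp add: tied_vector_def)
    next
      case 4
      then show ?thesis using D(8)[OF 4] i by (simp add: tied_vector_def)
    qed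
  qed
  have X_mem: "X t \<in> {c..1 / real i}" for t using X_ge X_le by simp
  have tied_pv: "tied_vector i (X t) \<in> prob_vectors k" for t
    using X_mem[of t] c by (intro tied_vector_prob_vectors i) auto
  have "(\<lambda>t. H_comp q k 1 (P t) - H_comp q k 1 (tied_vector i (X t))) \<longlonglongrightarrow> 0"
    using i by (intro tendsto_H_comp_diff D(1) tied_pv diff) auto
  moreover have "H_comp q k 1 (P t) = X (Suc t)" for t
    using i by (simp add: X_def Suc_P H_def)
  ultimately have "(\<lambda>t. X (Suc t) - h q i (X t)) \<longlonglongrightarrow> 0"
    unfolding H_comp_tied_1[OF i] by simp
  \<comment> \<open>The leading coordinate follows \<open>h q i\<close> up to a vanishing error
    inside the compact interval.\<close>
  then have X_lim: "X \<longlonglongrightarrow> x"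
    using c bas X_mem
    by (intro perturbed_orbit_converges[OF continuous_on_h[OF i(1)] _ _ _ attr,
          of "{c..1 / real i}"]) auto
  have "(\<lambda>t. P t j) \<longlonglongrightarrow> tied_vector i x j" for j
  proof -
    have "(\<lambda>t. tied_vector i (X t) j) \<longlonglongrightarrow> tied_vector i x j"
      unfolding tied_vector_def using X_lim by (auto intro!: tendsto_intros)
    from tendsto_add[OF diff[of j] this] show ?thesis by simp
  qed
  then show ?thesis unfolding P_def by (intro tendsto_funI)
qed

end

theorem proposition2p8:
  fixes q :: "nat pmf" and i k :: nat and x :: real
  assumes "pmf q 0 + pmf q 1 = 0"
    and "integrable (measure_pmf q) (\<lambda>N. real N * (real N - 1))"
    and "1 \<le> i" and "i \<le> k"
    and "linearly_attracting (h q i) {0..1 / real i} x"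
    and "{0<..1 / real i} \<subseteq> basin (h q i) {0..1 / real i} x"
  shows "x \<in> {0<..1 / real i} \<and>
    H q k \<in> Qspace_tied k i \<rightarrow> Qspace_tied k i \<and>
    globally_attracting (H q k) (Qspace_tied k i) (tied_vector i x)"
proof -
  interpret plurality q
  proof
    fix n assume "n \<in> set_pmf q"
    then have "0 < pmf q n" by (rule pmf_positive)
    moreover have "pmf q 0 = 0" "pmf q 1 = 0"
      using assms(1) pmf_nonneg[of q 0] pmf_nonneg[of q 1] by linarith+
    ultimately have "n \<noteq> 0" "n \<noteq> 1" by (metis less_irrefl)+
    then show "2 \<le> n" by simp
  qed
  have x: "x \<in> {0..1 / real i}" "h q i x = x"
    using assms(5) by (auto simp: linearly_attracting_def is_fixed_point_def)
  then have x_pos: "x \<in> {0<..1 / real i}"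
    using linearly_attracting_pos[OF assms(2,3,5)] by simp
  have fixed: "is_fixed_point (H q k) (Qspace_tied k i) (tied_vector i x)"
    using tied_vector_Qspace_tied[OF assms(3,4) x_pos] H_tied_vector[OF assms(3,4) x(1)] x(2)
    by (simp add: is_fixed_point_def)
  have basin: "Qspace_tied k i \<subseteq> basin (H q k) (Qspace_tied k i) (tied_vector i x)"
    using H_orbit_converges[OF assms(2-6)] by (auto simp: basin_def)
  \<comment> \<open>The basin is all of \<open>Qspace_tied k i\<close>, so any neighborhood of the
    fixed point witnesses attraction.\<close>
  then have "\<forall>\<^sub>F p in at (tied_vector i x) within Qspace_tied k i.
      p \<in> basin (H q k) (Qspace_tied k i) (tied_vector i x)"
    by (auto simp: eventually_at_topological)
  with fixed basin have "globally_attracting (H q k) (Qspace_tied k i) (tied_vector i x)"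
    by (simp add: globally_attracting_def attracting_def)
  then show ?thesis using x_pos H_Qspace_tied[OF _ assms(3,4)] by auto
qed

end
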